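(* Let $k\ge 3$, $n\ge k$, let $s_1,\dots,s_{k-1}$ be reals, and let $x\in S_k$. The following are equivalent: (1) $x$ is a local maximum of the function $y\mapsto\sum_{i=1}^n y_i^k$ on $S_k$; (2) there exist integers $1=i_1\le i_2\le\cdots\le i_k=n+1$ such that for each $j$, $x_{i_j}=x_{i_j+1}=\cdots=x_{i_{j+1}-1}$ (all coordinates with indices in $[i_j,i_{j+1})$ are equal), and $i_{2j}-i_{2j-1}\in\{0,1\}$ for each $j$ with $2j\le k$; (3) $x\succ_k y$ for all $y\in S_k$.
   Context: For integers $k\ge 3$, $n\ge k$ and reals $s_1,\dots,s_{k-1}$, $S_k:=\{(x_1,\dots,x_n)\in\mathbb{R}^n : x_1\ge x_2\ge\cdots\ge x_n,\ \sum_{i=1}^n x_i^j=s_j\text{ for }j=1,\dots,k-1\}$ with the subspace topology from $\mathbb{R}^n$. For $a,b\in\mathbb{R}^n$, $a\succ_k b$ means $\sum_{i=1}^n f(a_i)\ge\sum_{i=1}^n f(b_i)$ for every $k$ times differentiable $f:\mathbb{R}\to\mathbb{R}$ with $f^{(k)}\ge 0$. *)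

theory Defs
  imports Complex_Main
begin

text \<open>Vectors of \<real>^n are represented as functions nat \<Rightarrow> real, using only the
  coordinates 1..n (values at other indices are irrelevant).\<close>

definition S_set :: "nat \<Rightarrow> nat \<Rightarrow> (nat \<Rightarrow> real) \<Rightarrow> (nat \<Rightarrow> real) set" where
  "S_set k n s = {x. (\<forall>i\<in>{1..<n}. x (Suc i) \<le> x i) \<and>
                     (\<forall>j\<in>{1..k-1}. (\<Sum>i=1..n. x i ^ j) = s j)}"

definition dist_n :: "nat \<Rightarrow> (nat \<Rightarrow> real) \<Rightarrow> (nat \<Rightarrow> real) \<Rightarrow> real" where
  "dist_n n x y = sqrt (\<Sum>i=1..n. (x i - y i)^2)"

definition is_local_max_pow :: "nat \<Rightarrow> nat \<Rightarrow> (nat \<Rightarrow> real) \<Rightarrow> (nat \<Rightarrow> real) \<Rightarrow> bool" where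
  "is_local_max_pow k n s x \<longleftrightarrow> x \<in> S_set k n s \<and>
     (\<exists>e>0. \<forall>y\<in>S_set k n s. dist_n n y x < e \<longrightarrow> (\<Sum>i=1..n. y i ^ k) \<le> (\<Sum>i=1..n. x i ^ k))"

definition k_convex_fun :: "nat \<Rightarrow> (real \<Rightarrow> real) \<Rightarrow> bool" where
  "k_convex_fun k f \<longleftrightarrow> (\<exists>D :: nat \<Rightarrow> real \<Rightarrow> real. D 0 = f \<and>
     (\<forall>m<k. \<forall>t. (D m has_real_derivative D (Suc m) t) (at t)) \<and>
     (\<forall>t. D k t \<ge> 0))"

definition k_majorizes :: "nat \<Rightarrow> nat \<Rightarrow> (nat \<Rightarrow> real) \<Rightarrow> (nat \<Rightarrow> real) \<Rightarrow> bool" where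
  "k_majorizes k n a b \<longleftrightarrow>
     (\<forall>f. k_convex_fun k f \<longrightarrow> (\<Sum>i=1..n. f (a i)) \<ge> (\<Sum>i=1..n. f (b i)))"

end

(*
  (2) ==> (3): The counting functions of x and y on R differ by a function D, and the block structure
  of x leaves D at most k - 1 sign changes.  Choose nodes T_1 >= ... >= T_(k-1) at which these occur.  If the
  nodes are distinct, f' minus its interpolation polynomial p at the nodes is a nonnegative multiple of
  prod (t - T_l), which makes f(x_i) - P(x_i) >= f(y_i) - P(y_i) for each i, where P' = p; the sums of the
  polynomial P (of degree < k) over x and y agree.  If two nodes coincide, then dropping both factors
  leaves a polynomial q of the same sign pattern; for Q' = q of degree < k the equal sums of Q over x and y are
  sums of strictly ordered terms wherever x_i and y_i differ, so x = y.

  (3) ==> (1): The function t^k is k-convex.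

  (1) ==> (2): If the greedy choice of blocks does not reach n + 1, it exhibits indices c_1 < ... < c_k with
  x_(c_1) >= x_(c_2) > x_(c_3) >= x_(c_4) > ....  Hence prod (t - x_(c_l)) touches 0 from above at its double roots,
  so subtracting a small constant e > 0 keeps all k roots real.  By Newton's identities, moving
  these coordinates to the new roots keeps the first k - 1 power sums and increases the k-th by k e.
*)
theory Submission
  imports Defs "HOL-Computational_Algebra.Polynomial"
begin

subsection \<open>Interpolation\<close>

text \<open>Rolle's theorem between consecutive zeros in increasing order; the points found lie in
  disjoint open intervals, so they are distinct.\<close>

lemma Rolle_zeros:
  fixes f f' :: "real \<Rightarrow> real"
  assumes der: "\<And>t. (f has_real_derivative f' t) (at t)"
    and A: "card A = Suc m" "\<And>a. a \<in> A \<Longrightarrow> f a = 0"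
  obtains B where "card B = m" "\<And>b. b \<in> B \<Longrightarrow> f' b = 0"
proof -
  define xs where "xs = sorted_list_of_set A"
  have fin: "finite A" using A(1) by (intro card_ge_0_finite) auto
  have len: "length xs = Suc m" using A(1) by (simp add: xs_def)
  have mono: "xs ! i < xs ! j" if "i < j" "j \<le> m" for i j
    using strict_sorted_list_of_set[of A] that len by (simp add: xs_def sorted_wrt_nth_less)
  have zero: "f (xs ! i) = 0" if "i \<le> m" for i
    by (rule A(2)) (use that len fin nth_mem[of i xs] in \<open>simp add: xs_def\<close>)
  have "\<exists>z. xs ! i < z \<and> z < xs ! Suc i \<and> f' z = 0" if i: "i < m" for i
  proof -
    obtain z where "xs ! i < z" "z < xs ! Suc i"
      "f (xs ! Suc i) - f (xs ! i) = (xs ! Suc i - xs ! i) * f' z"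
      using MVT2[OF mono[of i "Suc i"] der] i by auto
    then show ?thesis using zero[of i] zero[of "Suc i"] i by auto
  qed
  then obtain z where z: "\<And>i. i < m \<Longrightarrow> xs ! i < z i \<and> z i < xs ! Suc i \<and> f' (z i) = 0"
    by metis
  have zmono: "z i < z j" if "i < j" "j < m" for i j
  proof -
    have "xs ! Suc i \<le> xs ! j" using mono[of "Suc i" j] that by (cases "Suc i = j") auto
    then show ?thesis using z[of i] z[of j] that by auto
  qed
  have "inj_on z {..<m}"
    by (rule linorder_inj_onI) (use zmono in \<open>force+\<close>)
  then have "card (z ` {..<m}) = m" by (simp add: card_image)
  then show ?thesis using z that[of "z ` {..<m}"] by auto
qed

text \<open>Each differentiation costs one zero, so \<open>m + 1\<close> zeros leave one after
  \<open>m\<close> steps.\<close>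

lemma Rolle_higher:
  fixes D :: "nat \<Rightarrow> real \<Rightarrow> real"
  assumes "\<And>j t. j < m \<Longrightarrow> (D j has_real_derivative D (Suc j) t) (at t)"
    and "card A = Suc m" "\<And>a. a \<in> A \<Longrightarrow> D 0 a = 0"
  shows "\<exists>t. D m t = 0"
  using assms
proof (induction m arbitrary: D A)
  case 0
  then show ?case by (metis card_1_singletonE insertI1 One_nat_def)
next
  case (Suc m)
  obtain B where "card B = Suc m" "\<And>b. b \<in> B \<Longrightarrow> D 1 b = 0"
    using Rolle_zeros[of "D 0" "D 1" A "Suc m"] Suc.prems by auto
  then show ?case using Suc.IH[of "\<lambda>j. D (Suc j)" B] Suc.prems(1) by auto
qed

section \<open>Monic products of linear factors and higher derivatives of polynomials\<close>

lemma degree_prod_linear: "degree (\<Prod>a\<in>A. [:- f a, 1::real:]) = card A"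
  by (simp add: degree_prod_eq_sum_degree)

lemma lead_coeff_prod_linear: "coeff (\<Prod>a\<in>A. [:- f a, 1::real:]) (card A) = 1"
  using lead_coeff_prod[of "\<lambda>a. [:- f a, 1:]" A] by (simp add: degree_prod_linear)

lemma poly_prod_linear: "poly (\<Prod>a\<in>A. [:- f a, 1::real:]) t = (\<Prod>a\<in>A. t - f a)"
  by (simp add: poly_prod algebra_simps)

lemma higher_pderiv_degree_less:
  fixes p :: "real poly"
  assumes "degree p < m"
  shows "(pderiv ^^ m) p = 0"
  by (rule poly_eqI) (use assms in \<open>simp add: coeff_higher_pderiv coeff_eq_0\<close>)

lemma poly_higher_pderiv_degree_eq:
  fixes p :: "real poly"
  assumes "degree p = m"
  shows "poly ((pderiv ^^ m) p) t = fact m * coeff p m"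
proof -
  have "(pderiv ^^ m) p = [:fact m * coeff p m:]"
    by (rule poly_eqI)
      (use assms in \<open>simp add: coeff_higher_pderiv coeff_eq_0 coeff_pCons pochhammer_fact split: nat.split\<close>)
  then show ?thesis by simp
qed

text \<open>Newton's form: the correction for a new node is a multiple of the nodal polynomial of
  the old ones, which leaves their values undisturbed.\<close>

lemma ex_interpolation_poly:
  fixes g :: "real \<Rightarrow> real"
  assumes "finite A" "A \<noteq> {}"
  shows "\<exists>p. degree p < card A \<and> (\<forall>a\<in>A. poly p a = g a)"
  using assms
proof (induction A rule: finite_ne_induct)
  case (singleton a)
  show ?case by (rule exI[of _ "[:g a:]"]) auto
next
  case (insert a A)
  then obtain p where p: "degree p < card A" "\<And>a. a \<in> A \<Longrightarrow> poly p a = g a" by auto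
  define W where "W = (\<Prod>b\<in>A. [:- b, 1:])"
  define c where "c = (g a - poly p a) / poly W a"
  have W: "poly W a \<noteq> 0" "\<And>b. b \<in> A \<Longrightarrow> poly W b = 0" "degree W = card A"
    using insert.hyps degree_prod_linear[of "\<lambda>b. b" A] by (auto simp: W_def poly_prod)
  show ?case
  proof (intro exI[of _ "p + smult c W"] conjI ballI)
    show "degree (p + smult c W) < card (insert a A)"
      using p(1) W(3) insert.hyps
      by (intro le_less_trans[OF degree_add_le_max]) (auto simp: less_Suc_eq_le)
    show "poly (p + smult c W) b = g b" if "b \<in> insert a A" for b
      using that p(2) W by (auto simp: c_def)
  qed
qed

text \<open>The Lagrange remainder, of which only the sign of the coefficient is kept. One
  \<open>p\<close> serves all \<open>t\<close>.\<close>

lemma interpolation_error: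
  fixes D :: "nat \<Rightarrow> real \<Rightarrow> real"
  assumes der: "\<And>j t. j < m \<Longrightarrow> (D j has_real_derivative D (Suc j) t) (at t)"
    and nonneg: "\<And>t. D m t \<ge> 0"
    and A: "card A = m" "m > 0"
  obtains p where "degree p < m" "\<And>t. \<exists>c\<ge>0. D 0 t - poly p t = c * (\<Prod>a\<in>A. t - a)"
proof -
  have fin: "finite A" "A \<noteq> {}" using A by (auto intro: card_ge_0_finite)
  obtain p where p: "degree p < m" "\<And>a. a \<in> A \<Longrightarrow> poly p a = D 0 a"
    using ex_interpolation_poly[OF fin, of "D 0"] A by auto
  have "\<exists>c\<ge>0. D 0 t - poly p t = c * (\<Prod>a\<in>A. t - a)" for t
  proof (cases "t \<in> A")
    case True
    then show ?thesis using p(2) by (intro exI[of _ 0]) auto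
  next
    case False
    define W where "W = (\<Prod>a\<in>A. [:- a, 1:])"
    have W: "degree W = m" "coeff W m = 1" "poly W s = (\<Prod>a\<in>A. s - a)" for s
      using degree_prod_linear[of "\<lambda>b. b" A] lead_coeff_prod_linear[of "\<lambda>b. b" A]
        poly_prod_linear[of "\<lambda>b. b" A s] A by (auto simp: W_def)
    have Wt: "poly W t \<noteq> 0" using False fin by (auto simp: W(3))
    \<comment> \<open>With this \<open>c\<close>, \<open>Q\<close> agrees with \<open>D 0\<close> at
      \<open>t\<close> as well as on \<open>A\<close>. The difference has \<open>m + 1\<close>
      zeros, so its \<open>m\<close>-th derivative, \<open>D m\<close> minus
      \<open>c * fact m\<close>, vanishes somewhere.\<close>
    define c where "c = (D 0 t - poly p t) / poly W t"
    define Q where "Q = p + smult c W"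
    have "\<exists>s. D m s - poly ((pderiv ^^ m) Q) s = 0"
    proof (rule Rolle_higher[where D = "\<lambda>j s. D j s - poly ((pderiv ^^ j) Q) s" and A = "insert t A"])
      show "card (insert t A) = Suc m" using False fin A by simp
      show "D 0 a - poly ((pderiv ^^ 0) Q) a = 0" if "a \<in> insert t A" for a
        using that p(2) Wt fin by (auto simp: Q_def c_def W(3))
      show "((\<lambda>s. D j s - poly ((pderiv ^^ j) Q) s) has_real_derivative
          D (Suc j) s - poly ((pderiv ^^ Suc j) Q) s) (at s)" if "j < m" for j s
        using der[OF that] poly_DERIV[of "(pderiv ^^ j) Q" s] by (auto intro: DERIV_diff)
    qed
    then obtain s where "D m s = poly ((pderiv ^^ m) Q) s" by auto
    also have "\<dots> = c * fact m"
      using poly_higher_pderiv_degree_eq[OF W(1), of s] W(2) higher_pderiv_degree_less[OF p(1)]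
      by (simp add: Q_def higher_pderiv_add higher_pderiv_smult)
    finally have "c \<ge> 0" using nonneg[of s] by (metis fact_gt_zero zero_le_mult_iff not_le)
    moreover have "D 0 t - poly p t = c * (\<Prod>a\<in>A. t - a)"
      using Wt by (simp add: c_def W(3))
    ultimately show ?thesis by blast
  qed
  with p(1) that show ?thesis by blast
qed

section \<open>Antiderivatives, powers and monotonicity\<close>

lemma ex_antiderivative_poly:
  fixes p :: "real poly"
  obtains P where "pderiv P = p" "degree P \<le> Suc (degree p)"
proof -
  define P where "P = (\<Sum>j\<le>degree p. monom (coeff p j / real (Suc j)) (Suc j))"
  have "pderiv P = (\<Sum>j\<le>degree p. monom (coeff p j) j)"
    by (simp add: P_def higher_pderiv_sum[of 1, simplified] pderiv_monom del: of_nat_Suc)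
  then have "pderiv P = p" using poly_as_sum_of_monoms[of p] by simp
  moreover have "degree P \<le> Suc (degree p)"
    unfolding P_def by (rule degree_sum_le) (auto intro: order_trans[OF degree_monom_le])
  ultimately show ?thesis using that by blast
qed

lemma k_convex_power: "k_convex_fun k (\<lambda>t. t ^ k)"
  unfolding k_convex_fun_def
proof (intro exI[of _ "\<lambda>j. poly ((pderiv ^^ j) (monom 1 k))"] conjI allI impI)
  show "poly ((pderiv ^^ 0) (monom 1 k)) = (\<lambda>t. t ^ k)" by (auto simp: poly_monom)
  show "0 \<le> poly ((pderiv ^^ k) (monom 1 k)) t" for t :: real
    by (simp add: poly_higher_pderiv_degree_eq degree_monom_eq)
qed auto

text \<open>Split the interval at the points of \<open>F\<close>, where the sign of
  \<open>f'\<close> is not known. In the application these are the nodes.\<close>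

lemma DERIV_pos_finite_imp_increasing:
  fixes f :: "real \<Rightarrow> real"
  assumes "finite F" "a < b"
    and "\<And>t. t \<in> {a<..<b} - F \<Longrightarrow> f' t > 0"
    and "\<And>t. (f has_real_derivative f' t) (at t)"
  shows "f a < f b"
  using assms
proof (induction F arbitrary: a b rule: finite_induct)
  case empty
  then show ?case
    by (intro DERIV_pos_imp_increasing_open[of a b f])
      (auto intro!: DERIV_atLeastAtMost_imp_continuous_on)
next
  case (insert c F)
  show ?case
  proof (cases "a < c \<and> c < b")
    case True
    have "f a < f c" "f c < f b"
      using True insert.prems by (auto intro!: insert.IH)
    then show ?thesis by simp
  next
    case False
    then show ?thesis using insert.prems by (intro insert.IH) auto
  qed
qed

lemma DERIV_nonneg_interior_imp_nondecreasing:
  fixes f :: "real \<Rightarrow> real"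
  assumes "a \<le> b"
    and "\<And>t. t \<in> {a<..<b} \<Longrightarrow> f' t \<ge> 0"
    and "\<And>t. (f has_real_derivative f' t) (at t)"
  shows "f a \<le> f b"
proof (cases "a = b")
  case False
  then obtain z where "a < z" "z < b" "f b - f a = (b - a) * f' z"
    using MVT2[of a b f f'] assms by force
  moreover from this have "(b - a) * f' z \<ge> 0" using assms by auto
  ultimately show ?thesis by linarith
qed auto

subsection \<open>Block structure implies majorization\<close>

text \<open>Condition (2) verbatim, so that unfolding it ends the proof of the theorem. The
  subtraction on \<open>nat\<close> truncates nothing, since the bounds are monotone.\<close>

definition block_bounds :: "nat \<Rightarrow> nat \<Rightarrow> (nat \<Rightarrow> real) \<Rightarrow> (nat \<Rightarrow> nat) \<Rightarrow> bool" where
  "block_bounds k n x i \<longleftrightarrow> i 1 = 1 \<and> i k = n + 1 \<and>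
     (\<forall>j\<in>{1..<k}. i j \<le> i (Suc j)) \<and>
     (\<forall>j\<in>{1..<k}. \<forall>a\<in>{i j..<i (Suc j)}. \<forall>b\<in>{i j..<i (Suc j)}. x a = x b) \<and>
     (\<forall>j. 1 \<le> j \<and> 2 * j \<le> k \<longrightarrow> i (2 * j) - i (2 * j - 1) \<in> {0, 1})"

section \<open>Sorted coordinates and sums of polynomials on \<open>S_set\<close>\<close>

lemma sorted_coords:
  assumes "x \<in> S_set k n s" "1 \<le> a" "a \<le> b" "b \<le> n"
  shows "x b \<le> x a"
proof -
  have "b \<le> n \<longrightarrow> x b \<le> x a"
    using \<open>a \<le> b\<close>
  proof (induction b rule: dec_induct)
    case (step m)
    show ?case
    proof
      assume "Suc m \<le> n"
      then have "x (Suc m) \<le> x m" using assms(1,2) step.hyps by (simp add: S_set_def)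
      then show "x (Suc m) \<le> x a" using step.IH \<open>Suc m \<le> n\<close> by simp
    qed
  qed simp
  then show ?thesis using assms by simp
qed

text \<open>Expanded by coefficients, either sum depends only on \<open>n\<close> and the prescribed
  values \<open>s j\<close>.\<close>

lemma sum_poly_eq:
  fixes x y :: "nat \<Rightarrow> real"
  assumes "x \<in> S_set k n s" "y \<in> S_set k n s" "degree p < k"
  shows "(\<Sum>i=1..n. poly p (x i)) = (\<Sum>i=1..n. poly p (y i))"
proof -
  have *: "(\<Sum>i=1..n. poly p (z i)) = coeff p 0 * n + (\<Sum>j=1..degree p. coeff p j * s j)"
    if z: "z \<in> S_set k n s" for z
  proof -
    have "(\<Sum>i=1..n. poly p (z i)) = (\<Sum>i=1..n. \<Sum>j\<le>degree p. coeff p j * z i ^ j)"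
      by (simp add: poly_altdef)
    also have "\<dots> = (\<Sum>j\<le>degree p. \<Sum>i=1..n. coeff p j * z i ^ j)"
      by (rule sum.swap)
    also have "\<dots> = (\<Sum>j\<le>degree p. coeff p j * (\<Sum>i=1..n. z i ^ j))"
      by (simp add: sum_distrib_left)
    also have "\<dots> = coeff p 0 * n + (\<Sum>j=1..degree p. coeff p j * (\<Sum>i=1..n. z i ^ j))"
      by (simp add: atMost_atLeast0 sum.atLeast_Suc_atMost[of 0])
    also have "(\<Sum>j=1..degree p. coeff p j * (\<Sum>i=1..n. z i ^ j)) = (\<Sum>j=1..degree p. coeff p j * s j)"
      using z assms(3) by (intro sum.cong refl) (auto simp: S_set_def)
    finally show ?thesis .
  qed
  show ?thesis using *[OF assms(1)] *[OF assms(2)] by simp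
qed

section \<open>Sign of a product with sorted roots, and the choice of nodes\<close>

lemma prod_linear_sign:
  fixes T :: "nat \<Rightarrow> real"
  assumes "\<And>l. 1 \<le> l \<Longrightarrow> l \<le> N \<Longrightarrow> t < T l" "\<And>l. N < l \<Longrightarrow> l \<le> m \<Longrightarrow> T l < t" "N \<le> m"
  shows "(- 1) ^ N * (\<Prod>l=1..m. t - T l) > 0"
proof -
  have eq: "{1..m} = {1..N} \<union> {N<..m}" using assms(3) by auto
  have "(\<Prod>l=1..m. t - T l) = (\<Prod>l=1..N. t - T l) * (\<Prod>l\<in>{N<..m}. t - T l)"
    unfolding eq by (rule prod.union_disjoint) auto
  also have "(\<Prod>l=1..N. t - T l) = (\<Prod>l=1..N. (-1) * (T l - t))" by simp
  also have "\<dots> = (- 1) ^ N * (\<Prod>l=1..N. T l - t)" by (simp only: prod.distrib) simp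
  finally have "(- 1) ^ N * (\<Prod>l=1..m. t - T l)
      = ((- 1) ^ N * (- 1) ^ N) * ((\<Prod>l=1..N. T l - t) * (\<Prod>l\<in>{N<..m}. t - T l))"
    by (simp only: mult.assoc mult.left_commute)
  moreover have "(\<Prod>l=1..N. T l - t) > 0" "(\<Prod>l\<in>{N<..m}. t - T l) > 0"
    using assms by (auto intro!: prod_pos)
  moreover have "(- 1 :: real) ^ N * (- 1) ^ N = 1"
    by (simp flip: power_mult_distrib)
  ultimately show ?thesis by simp
qed

text \<open>\<open>N\<close> counts the nodes above \<open>t\<close>; its parity decides the sign of
  the nodal product at \<open>t\<close>.\<close>

lemma ex_threshold:
  fixes T :: "nat \<Rightarrow> real"
  assumes anti: "\<And>l. 1 \<le> l \<Longrightarrow> l < m \<Longrightarrow> T (Suc l) \<le> T l"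
    and "t \<notin> T ` {1..m}"
  obtains N where "N \<le> m" "\<And>l. 1 \<le> l \<Longrightarrow> l \<le> N \<Longrightarrow> t < T l"
    "\<And>l. N < l \<Longrightarrow> l \<le> m \<Longrightarrow> T l < t"
  using assms
proof (induction m arbitrary: thesis)
  case 0
  show ?case by (rule "0.prems"(1)[of 0]) auto
next
  case (Suc m)
  obtain N where N: "N \<le> m" "\<And>l. 1 \<le> l \<Longrightarrow> l \<le> N \<Longrightarrow> t < T l"
    "\<And>l. N < l \<Longrightarrow> l \<le> m \<Longrightarrow> T l < t"
    by (rule Suc.IH) (use Suc.prems in auto)
  have ne: "t \<noteq> T (Suc m)" using Suc.prems(3) by auto
  show ?case
  proof (cases "t < T (Suc m)")
    case True
    have "N = m"
    proof (rule ccontr)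
      assume "N \<noteq> m"
      then have "T m < t" "T (Suc m) \<le> T m" using N(1,3) Suc.prems(2)[of m] by auto
      then show False using True by simp
    qed
    then show ?thesis using N True by (intro Suc.prems(1)[of "Suc m"]) (auto simp: le_Suc_eq)
  next
    case False
    then show ?thesis using N ne by (intro Suc.prems(1)[of N]) (auto simp: le_Suc_eq)
  qed
qed

text \<open>The number \<open>N\<close> of nodes above \<open>t\<close> must be even if
  \<open>x i\<close> is the larger coordinate and odd if \<open>y i\<close> is. The wrong parity
  puts \<open>i\<close> at or beyond \<open>I (Suc N)\<close>, and sortedness of \<open>x\<close> or
  \<open>y\<close> then forces \<open>x i\<close> or \<open>y i\<close> across
  \<open>t\<close>.\<close>

lemma ex_sign_nodes:
  assumes "k \<ge> 2" and x: "x \<in> S_set k n s" and y: "y \<in> S_set k n s"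
    and I: "block_bounds k n x I"
  obtains T :: "nat \<Rightarrow> real" where
    "\<And>i t. i \<in> {1..n} \<Longrightarrow> y i < t \<Longrightarrow> t < x i \<Longrightarrow> t \<notin> T ` {1..k-1} \<Longrightarrow> (\<Prod>l=1..k-1. t - T l) > 0"
    "\<And>i t. i \<in> {1..n} \<Longrightarrow> x i < t \<Longrightarrow> t < y i \<Longrightarrow> t \<notin> T ` {1..k-1} \<Longrightarrow> (\<Prod>l=1..k-1. t - T l) < 0"
proof (cases "n = 0")
  case True
  then show ?thesis by (intro that[of "\<lambda>_. 0"]) auto
next
  case n: False
  have I1: "I 1 = 1" and Ik: "I k = n + 1"
    and Imono: "\<And>j. 1 \<le> j \<Longrightarrow> j < k \<Longrightarrow> I j \<le> I (Suc j)"
    using I unfolding block_bounds_def by simp_all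
  have Iconst: "\<And>j a b. 1 \<le> j \<Longrightarrow> j < k \<Longrightarrow> I j \<le> a \<Longrightarrow> a < I (Suc j) \<Longrightarrow> I j \<le> b \<Longrightarrow> b < I (Suc j) \<Longrightarrow> x a = x b"
    using I unfolding block_bounds_def by (meson atLeastLessThan_iff)
  have Iodd: "I (Suc l) \<le> Suc (I l)" if "odd l" "l < k" for l
  proof -
    obtain j where "l = 2 * j + 1" using \<open>odd l\<close> by (elim oddE)
    then have "1 \<le> Suc j \<and> 2 * Suc j \<le> k" using that by simp
    then have "I (2 * Suc j) - I (2 * Suc j - 1) \<in> {0, 1}" using I unfolding block_bounds_def by blast
    then show ?thesis using \<open>l = _\<close> by auto
  qed
  have Imono': "I j \<le> I j'" if "1 \<le> j" "j \<le> j'" "j' \<le> k" for j j'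
    using that(2,1,3) by (induction j' rule: dec_induct) (auto intro: order_trans[OF _ Imono])
  have Ige: "1 \<le> I j" if "1 \<le> j" "j \<le> k" for j using Imono'[of 1 j] that I1 by simp
  define c where "c l = min (I l) n" for l
  have c: "1 \<le> c l" "c l \<le> n" if "1 \<le> l" "l \<le> k" for l using Ige[OF that] n by (auto simp: c_def)
  define M where "M = Max ((\<lambda>i. \<bar>x i\<bar>) ` {1..n} \<union> (\<lambda>i. \<bar>y i\<bar>) ` {1..n})"
  have M: "\<bar>x i\<bar> \<le> M" "\<bar>y i\<bar> \<le> M" if "i \<in> {1..n}" for i
    unfolding M_def using that by (auto intro!: Max_ge)
  \<comment> \<open>Even nodes sit on the values of the even blocks. The odd node \<open>l\<close> is the coordinate of \<open>y\<close> whose index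
    starts block \<open>l\<close>, clamped between the neighbouring even nodes; \<open>M\<close> and \<open>- M\<close> play the role of the infinite
    ends. The minimum in \<open>c\<close> covers empty blocks at the end, which start at index \<open>n + 1\<close>.\<close>
  define E where "E l = (if l = 0 then M else if l < k then x (c l) else - M)" for l
  define T where "T l = (if even l then E l else max (E (Suc l)) (min (E (l - 1)) (y (c l))))" for l
  have Eanti: "E l' \<le> E l" if "l \<le> l'" for l l'
  proof -
    have "x (c l') \<le> x (c l)" if "1 \<le> l" "l \<le> l'" "l' < k" for l l'
      by (rule sorted_coords[OF x]) (use c[of l] c[of l'] Imono'[of l l'] that in \<open>auto simp: c_def\<close>)
    moreover have "x (c l) \<le> M" "- M \<le> x (c l)" if "1 \<le> l" "l < k" for l
      using M(1)[of "c l"] c[of l] that by auto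
    moreover have "- M \<le> M" using M(1)[of 1] n by auto
    ultimately show ?thesis using \<open>l \<le> l'\<close> by (auto simp: E_def)
  qed
  have Tanti: "T (Suc l) \<le> T l" for l
    using Eanti[of l "l + 2"] Eanti[of "l - 1" l] Eanti[of l "Suc l"] Eanti[of "l - 1" "Suc l"]
    by (auto simp: T_def)
  have N: "\<exists>N. N \<le> k - 1 \<and> (\<forall>l. 1 \<le> l \<and> l \<le> N \<longrightarrow> t < T l) \<and> (\<forall>l. N < l \<and> l \<le> k - 1 \<longrightarrow> T l < t)
      \<and> (- 1) ^ N * (\<Prod>l=1..k-1. t - T l) > 0 \<and>
      (N \<ge> 1 \<longrightarrow> t < T N) \<and> (N < k - 1 \<longrightarrow> T (Suc N) < t)"
    if t: "t \<notin> T ` {1..k-1}" for t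
  proof -
    obtain N where N: "N \<le> k - 1" "\<And>l. 1 \<le> l \<Longrightarrow> l \<le> N \<Longrightarrow> t < T l"
      "\<And>l. N < l \<Longrightarrow> l \<le> k - 1 \<Longrightarrow> T l < t"
      by (rule ex_threshold[of "k - 1" T t, OF Tanti t]) blast
    show ?thesis using N prod_linear_sign[OF N(2,3,1)] by (intro exI[of _ N]) auto
  qed
  show ?thesis
  proof (rule that[of T])
    fix i t assume i: "i \<in> {1..n}" and t: "y i < t" "t < x i" and "t \<notin> T ` {1..k-1}"
    then obtain N where N: "N \<le> k - 1" "(- 1) ^ N * (\<Prod>l=1..k-1. t - T l) > 0"
      "N \<ge> 1 \<longrightarrow> t < T N" "N < k - 1 \<longrightarrow> T (Suc N) < t"
      using N[of t] by auto
    \<comment> \<open>For odd \<open>N\<close> the node above \<open>t\<close> gives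
      \<open>t < y (c N)\<close>, so \<open>i\<close> lies beyond \<open>c N\<close>. Block
      \<open>N\<close> has at most one index, so \<open>i\<close> lies beyond the whole block,
      whence \<open>x i \<le> E (Suc N) < t\<close>.\<close>
    have "even N"
    proof (rule ccontr)
      assume odd: "odd N"
      then have N1: "1 \<le> N" "N < k" using N(1) \<open>k \<ge> 2\<close> by (auto elim: oddE)
      have Elt: "E (Suc N) < t"
      proof (cases "N < k - 1")
        case True
        then show ?thesis using N(4) odd by (simp add: T_def)
      next
        case False
        then show ?thesis using M[OF i] t N1 by (auto simp: E_def)
      qed
      have "t < y (c N)"
        using N(3) N1 Elt odd by (auto simp: T_def)
      then have "i > c N" using sorted_coords[OF y, of i "c N"] c[of N] N1 i t by force
      then have "i \<ge> I (Suc N)" using Iodd[OF odd N1(2)] i by (auto simp: c_def)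
      moreover have "Suc N < k"
      proof (rule ccontr)
        assume "\<not> Suc N < k"
        then have "Suc N = k" using N1 by simp
        then show False using \<open>i \<ge> I (Suc N)\<close> Ik i by auto
      qed
      ultimately have "x i \<le> E (Suc N)"
        using sorted_coords[OF x, of "c (Suc N)" i] c[of "Suc N"] i by (auto simp: E_def c_def)
      then show False using Elt t by simp
    qed
    then show "(\<Prod>l=1..k-1. t - T l) > 0" using N(2) by simp
  next
    fix i t assume i: "i \<in> {1..n}" and t: "x i < t" "t < y i" and "t \<notin> T ` {1..k-1}"
    then obtain N where N: "N \<le> k - 1" "(- 1) ^ N * (\<Prod>l=1..k-1. t - T l) > 0"
      "N \<ge> 1 \<longrightarrow> t < T N" "N < k - 1 \<longrightarrow> T (Suc N) < t"
      using N[of t] by auto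
    \<comment> \<open>For even \<open>N\<close>, \<open>x i < t < E N\<close> rules out that
      \<open>i\<close> lies in block \<open>N\<close> or before it. Hence
      \<open>y i \<le> y (c (Suc N)) < t\<close>, or there is no block left for
      \<open>i\<close>.\<close>
    have "odd N"
    proof (rule ccontr)
      assume "\<not> odd N"
      then have ev: "even N" by simp
      have Egt: "t < E N"
        using M[OF i] t N(3) ev by (cases "N = 0") (auto simp: E_def T_def)
      have key: "i \<ge> I (Suc N)"
      proof (rule ccontr)
        assume less: "\<not> i \<ge> I (Suc N)"
        then have N1: "1 \<le> N" using I1 i by (cases N) auto
        have "N < k" using N(1) \<open>k \<ge> 2\<close> by simp
        have "x i \<ge> E N"
        proof (cases "i < I N")
          case True
          then show ?thesis
            using sorted_coords[OF x, of i "c N"] c[of N] N1 \<open>N < k\<close> i by (auto simp: E_def c_def)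
        next
          case False
          then have "x i = x (I N)" "I N \<le> n"
            using Iconst[of N i "I N"] N1 \<open>N < k\<close> less i by auto
          then show ?thesis using N1 \<open>N < k\<close> by (simp add: E_def c_def)
        qed
        then show False using Egt t by simp
      qed
      show False
      proof (cases "N < k - 1")
        case True
        then have "T (Suc N) < t" using N(4) by simp
        then have "y (c (Suc N)) < t" using ev Egt by (auto simp: T_def)
        moreover have "y i \<le> y (c (Suc N))"
          using sorted_coords[OF y, of "c (Suc N)" i] c[of "Suc N"] key i True by (auto simp: c_def)
        ultimately show False using t by simp
      next
        case False
        then have "Suc N = k" using N(1) \<open>k \<ge> 2\<close> by simp
        then show False using key Ik i by simp
      qed
    qed
    then show "(\<Prod>l=1..k-1. t - T l) < 0" using N(2) by simp
  qed
qed

lemma block_bounds_imp_majorizes: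
  assumes "k \<ge> 3" and x: "x \<in> S_set k n s" and y: "y \<in> S_set k n s"
    and I: "block_bounds k n x I"
  shows "k_majorizes k n x y"
  unfolding k_majorizes_def
proof (intro allI impI)
  fix f assume "k_convex_fun k f"
  then obtain D where D: "D 0 = f" "\<And>m t. m < k \<Longrightarrow> (D m has_real_derivative D (Suc m) t) (at t)"
    "\<And>t. D k t \<ge> 0"
    by (auto simp: k_convex_fun_def)
  obtain T :: "nat \<Rightarrow> real" where
    T: "\<And>i t. i \<in> {1..n} \<Longrightarrow> y i < t \<Longrightarrow> t < x i \<Longrightarrow> t \<notin> T ` {1..k-1} \<Longrightarrow> (\<Prod>l=1..k-1. t - T l) > 0"
    "\<And>i t. i \<in> {1..n} \<Longrightarrow> x i < t \<Longrightarrow> t < y i \<Longrightarrow> t \<notin> T ` {1..k-1} \<Longrightarrow> (\<Prod>l=1..k-1. t - T l) < 0"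
    using ex_sign_nodes[OF _ x y I] \<open>k \<ge> 3\<close> by auto
  show "(\<Sum>i=1..n. f (y i)) \<le> (\<Sum>i=1..n. f (x i))"
  proof (cases "inj_on T {1..k-1}")
    case True
    \<comment> \<open>The function interpolated is \<open>f'\<close>, whose derivative of order
      \<open>k - 1\<close> is \<open>D k\<close>; hence the shift of \<open>D\<close>.\<close>
    obtain p where p: "degree p < k - 1"
      "\<And>t. \<exists>c\<ge>0. D 1 t - poly p t = c * (\<Prod>a\<in>T ` {1..k-1}. t - a)"
    proof (rule interpolation_error[where D = "\<lambda>j. D (Suc j)" and m = "k - 1" and A = "T ` {1..k-1}"])
      show "card (T ` {1..k-1}) = k - 1" using True by (simp add: card_image)
    qed (use D \<open>k \<ge> 3\<close> in auto)
    have p2: "\<exists>c\<ge>0. D 1 t - poly p t = c * (\<Prod>l=1..k-1. t - T l)" for t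
      using p(2)[of t] True by (simp add: prod.reindex)
    have node: "(\<Prod>l=1..k-1. t - T l) = 0" if "t \<in> T ` {1..k-1}" for t
      using that by (intro prod_zero) auto
    obtain P where P: "pderiv P = p" "degree P \<le> Suc (degree p)" by (rule ex_antiderivative_poly)
    have der: "((\<lambda>t. f t - poly P t) has_real_derivative D 1 t - poly p t) (at t)" for t
      using D(1) D(2)[of 0 t] \<open>k \<ge> 3\<close> poly_DERIV[of P t] P(1) by (auto intro!: DERIV_diff)
    have "f (y i) - poly P (y i) \<le> f (x i) - poly P (x i)" if i: "i \<in> {1..n}" for i
    proof (cases "y i \<le> x i")
      case True
      show ?thesis
      proof (rule DERIV_nonneg_interior_imp_nondecreasing[OF True _ der])
        fix t assume "t \<in> {y i<..<x i}"
        then have "(\<Prod>l=1..k-1. t - T l) \<ge> 0"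
          using T(1)[OF i, of t] node[of t] by (metis greaterThanLessThan_iff less_imp_le order_refl)
        then show "D 1 t - poly p t \<ge> 0" using p2[of t] by (metis mult_nonneg_nonneg)
      qed
    next
      case False
      have "- (f (x i) - poly P (x i)) \<le> - (f (y i) - poly P (y i))"
      proof (rule DERIV_nonneg_interior_imp_nondecreasing[OF _ _ DERIV_minus[OF der]])
        fix t assume "t \<in> {x i<..<y i}"
        then have "(\<Prod>l=1..k-1. t - T l) \<le> 0"
          using T(2)[OF i, of t] node[of t] by (metis greaterThanLessThan_iff less_imp_le order_refl)
        then show "- (D 1 t - poly p t) \<ge> 0" using p2[of t] by (metis mult_nonneg_nonpos neg_0_le_iff_le)
      qed (use False in auto)
      then show ?thesis by simp
    qed
    then have "(\<Sum>i=1..n. f (y i) - poly P (y i)) \<le> (\<Sum>i=1..n. f (x i) - poly P (x i))"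
      by (rule sum_mono)
    moreover have "(\<Sum>i=1..n. poly P (x i)) = (\<Sum>i=1..n. poly P (y i))"
      by (rule sum_poly_eq[OF x y]) (use P(2) p(1) in simp)
    ultimately show ?thesis by (simp add: sum_subtractf)
  next
    case False
    then obtain a b where ab: "a \<in> {1..k-1}" "b \<in> {1..k-1}" "a \<noteq> b" "T a = T b"
      by (auto simp: inj_on_def)
    \<comment> \<open>An antiderivative of the full product would have degree \<open>k\<close>, out
      of reach of \<open>sum_poly_eq\<close>. Without the square factor its degree is at most
      \<open>k - 2\<close>, while \<open>q\<close> keeps every strict sign of the product.\<close>
    define B where "B = {1..k-1} - {a, b}"
    define q where "q = (\<Prod>l\<in>B. [:- T l, 1:])"
    have card: "card B = k - 3" using ab by (simp add: B_def card_Diff_subset)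
    have split: "(\<Prod>l=1..k-1. t - T l) = (t - T a)\<^sup>2 * poly q t" for t
    proof -
      have "{1..k-1} = insert a (insert b B)" using ab by (auto simp: B_def)
      then have "(\<Prod>l=1..k-1. t - T l) = (\<Prod>l\<in>insert a (insert b B). t - T l)" by simp
      also have "\<dots> = (t - T a) * ((t - T b) * (\<Prod>l\<in>B. t - T l))"
        using ab by (simp add: B_def)
      finally show ?thesis using ab by (simp add: q_def poly_prod_linear power2_eq_square)
    qed
    have qsign: "(\<Prod>l=1..k-1. t - T l) > 0 \<Longrightarrow> poly q t > 0"
      "(\<Prod>l=1..k-1. t - T l) < 0 \<Longrightarrow> poly q t < 0" for t
      unfolding split by (auto simp: zero_less_mult_iff mult_less_0_iff)
    have degq: "degree q = k - 3" by (simp add: q_def degree_prod_linear card)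
    obtain Q where Q: "pderiv Q = q" "degree Q \<le> Suc (degree q)" by (rule ex_antiderivative_poly)
    have der: "(poly Q has_real_derivative poly q t) (at t)" for t
      using poly_DERIV[of Q t] Q(1) by simp
    have lt: "poly Q (y i) < poly Q (x i)" if i: "i \<in> {1..n}" and ne: "x i \<noteq> y i" for i
    proof (cases "y i < x i")
      case True
      show ?thesis
        by (rule DERIV_pos_finite_imp_increasing[of "T ` {1..k-1}", OF _ True _ der])
          (use qsign(1)[OF T(1)[OF i]] in auto)
    next
      case False
      have "- poly Q (x i) < - poly Q (y i)"
        by (rule DERIV_pos_finite_imp_increasing[of "T ` {1..k-1}", OF _ _ _ DERIV_minus[OF der]])
          (use qsign(2)[OF T(2)[OF i]] False ne in auto)
      then show ?thesis by simp
    qed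
    have "x i = y i" if "i \<in> {1..n}" for i
    proof (rule ccontr)
      assume "x i \<noteq> y i"
      then have "(\<Sum>i=1..n. poly Q (y i)) < (\<Sum>i=1..n. poly Q (x i))"
        using that lt by (intro sum_strict_mono_ex1) (simp, metis less_imp_le order_refl, blast)
      moreover have "(\<Sum>i=1..n. poly Q (x i)) = (\<Sum>i=1..n. poly Q (y i))"
        by (rule sum_poly_eq[OF x y]) (use Q(2) degq \<open>k \<ge> 3\<close> in simp)
      ultimately show False by simp
    qed
    then show ?thesis by simp
  qed
qed

subsection \<open>Lowering the constant coefficient of a polynomial\<close>

text \<open>Synthetic division by \<open>t - f i\<close> yields the coefficients of the quotients
  \<open>Q i\<close>, and these add up to \<open>pderiv P\<close>. The sum includes
  \<open>l = j\<close>, where the power sum is \<open>card L\<close>; this turns the usual factor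
  \<open>- j\<close> on the left into \<open>card L - j\<close>.\<close>

lemma newton_sums:
  fixes f :: "'a \<Rightarrow> real"
  assumes "finite L" "j < card L"
  defines "P \<equiv> \<Prod>i\<in>L. [:- f i, 1:]"
  shows "real (card L - j) * coeff P (card L - j) = (\<Sum>l\<le>j. coeff P (card L - l) * (\<Sum>i\<in>L. f i ^ (j - l)))"
proof -
  define Q where "Q i = (\<Prod>l\<in>L - {i}. [:- f l, 1:])" for i
  have Q: "coeff (Q i) (card L - 1 - m) = (\<Sum>l\<le>m. coeff P (card L - l) * f i ^ (m - l))"
    if "i \<in> L" "m < card L" for i m
    using that(2)
  proof (induction m)
    case 0
    show ?case
      using lead_coeff_prod_linear[of f L] lead_coeff_prod_linear[of f "L - {i}"] that(1) assms(1)
      by (simp add: P_def Q_def)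
  next
    case (Suc m)
    have "P = [:- f i, 1:] * Q i" using assms(1) that(1) by (simp add: P_def Q_def prod.remove)
    moreover have "coeff ([:- f i, 1:] * q) (Suc r) = coeff q r - f i * coeff q (Suc r)" for q r
      by simp
    ultimately have "coeff P (Suc r) = coeff (Q i) r - f i * coeff (Q i) (Suc r)" for r
      by metis
    from this[of "card L - 1 - Suc m"]
    have "coeff (Q i) (card L - 1 - Suc m) = coeff P (card L - Suc m) + f i * coeff (Q i) (card L - 1 - m)"
      using Suc.prems by (simp add: Suc_diff_Suc)
    also have "\<dots> = coeff P (card L - Suc m) + f i * (\<Sum>l\<le>m. coeff P (card L - l) * f i ^ (m - l))"
      using Suc by simp
    also have "\<dots> = (\<Sum>l\<le>Suc m. coeff P (card L - l) * f i ^ (Suc m - l))"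
      by (simp add: sum_distrib_left Suc_diff_le mult.left_commute)
    finally show ?case .
  qed
  have "pderiv P = (\<Sum>i\<in>L. Q i)" by (simp add: P_def Q_def pderiv_prod pderiv_pCons)
  moreover have "coeff (pderiv P) (card L - 1 - j) = real (card L - j) * coeff P (card L - j)"
    using assms(2) by (simp add: coeff_pderiv Suc_diff_Suc del: of_nat_Suc)
  ultimately have "real (card L - j) * coeff P (card L - j) = (\<Sum>i\<in>L. coeff (Q i) (card L - 1 - j))"
    by (simp add: coeff_sum)
  also have "\<dots> = (\<Sum>i\<in>L. \<Sum>l\<le>j. coeff P (card L - l) * f i ^ (j - l))"
    using Q assms(2) by simp
  also have "\<dots> = (\<Sum>l\<le>j. coeff P (card L - l) * (\<Sum>i\<in>L. f i ^ (j - l)))"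
    by (subst sum.swap) (simp add: sum_distrib_left)
  finally show ?thesis .
qed

text \<open>Newton's identities express the power sums of order below \<open>card L\<close> through
  the nonconstant coefficients, which both products share. For the top order, sum \<open>P\<close>
  over both families: it is 0 at each \<open>w l\<close> and \<open>e\<close> at each
  \<open>u l\<close>.\<close>

lemma power_sums_shift_const:
  fixes u w :: "'a \<Rightarrow> real"
  assumes L: "finite L"
    and eq: "(\<Prod>l\<in>L. [:- u l, 1:]) = (\<Prod>l\<in>L. [:- w l, 1:]) - [:e:]"
  shows "j < card L \<Longrightarrow> (\<Sum>l\<in>L. u l ^ j) = (\<Sum>l\<in>L. w l ^ j)"
    and "(\<Sum>l\<in>L. u l ^ card L) = (\<Sum>l\<in>L. w l ^ card L) + real (card L) * e"
proof -
  define P where "P = (\<Prod>l\<in>L. [:- w l, 1:])"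
  have coeff: "coeff (\<Prod>l\<in>L. [:- u l, 1:]) m = coeff P m" if "m \<ge> 1" for m
    using that by (cases m) (auto simp: eq P_def)
  show low: "(\<Sum>l\<in>L. u l ^ j) = (\<Sum>l\<in>L. w l ^ j)" if "j < card L" for j
    using that
  proof (induction j rule: less_induct)
    case (less j)
    have expand: "(\<Sum>l\<in>L. f l ^ j) = real (card L - j) * coeff P (card L - j)
        - (\<Sum>i=1..j. coeff P (card L - i) * (\<Sum>l\<in>L. f l ^ (j - i)))"
      if f: "\<And>m. m \<ge> 1 \<Longrightarrow> coeff (\<Prod>l\<in>L. [:- f l, 1:]) m = coeff P m" for f
    proof -
      have "real (card L - j) * coeff P (card L - j) = (\<Sum>i\<le>j. coeff P (card L - i) * (\<Sum>l\<in>L. f l ^ (j - i)))"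
        using newton_sums[OF L less.prems, of f] f less.prems by simp
      also have "\<dots> = coeff P (card L) * (\<Sum>l\<in>L. f l ^ j)
          + (\<Sum>i=1..j. coeff P (card L - i) * (\<Sum>l\<in>L. f l ^ (j - i)))"
        by (simp add: atMost_atLeast0 sum.atLeast_Suc_atMost[of 0])
      finally show ?thesis using lead_coeff_prod_linear[of w L] by (simp add: P_def)
    qed
    have "(\<Sum>i=1..j. coeff P (card L - i) * (\<Sum>l\<in>L. u l ^ (j - i)))
        = (\<Sum>i=1..j. coeff P (card L - i) * (\<Sum>l\<in>L. w l ^ (j - i)))"
      using less by (intro sum.cong refl) simp
    then show ?case using expand[of u] expand[of w] coeff by (simp add: P_def)
  qed
  have sum_P: "(\<Sum>l\<in>L. poly P (f l)) = (\<Sum>m<card L. coeff P m * (\<Sum>l\<in>L. f l ^ m)) + (\<Sum>l\<in>L. f l ^ card L)"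
    for f
  proof -
    have "(\<Sum>l\<in>L. poly P (f l)) = (\<Sum>l\<in>L. \<Sum>m\<le>card L. coeff P m * f l ^ m)"
      by (simp add: poly_altdef P_def degree_prod_linear)
    also have "\<dots> = (\<Sum>m\<le>card L. coeff P m * (\<Sum>l\<in>L. f l ^ m))"
      by (subst sum.swap) (simp add: sum_distrib_left)
    finally show ?thesis
      using lead_coeff_prod_linear[of w L] by (simp add: P_def flip: lessThan_Suc_atMost)
  qed
  have "poly P (w l) = 0" if "l \<in> L" for l
    using that L by (auto simp: P_def poly_prod_linear)
  moreover have "poly P (u l) = e" if "l \<in> L" for l
  proof -
    have "poly (\<Prod>l\<in>L. [:- u l, 1:]) (u l) = 0" using that L by (auto simp: poly_prod_linear)
    then show ?thesis by (simp add: eq P_def)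
  qed
  ultimately show "(\<Sum>l\<in>L. u l ^ card L) = (\<Sum>l\<in>L. w l ^ card L) + real (card L) * e"
    using sum_P[of u] sum_P[of w] low by simp
qed

text \<open>Between each \<open>w l\<close> and a nearby point where \<open>P\<close> exceeds
  \<open>e\<close> lies a root of \<open>P - [:e:]\<close>. These \<open>k\<close> roots are
  distinct, so they are all the roots of this monic polynomial of degree \<open>k\<close>.\<close>

lemma ex_shifted_roots:
  fixes w :: "nat \<Rightarrow> real"
  assumes "k \<ge> 1" "d > 0"
    and odd: "\<And>l. 1 \<le> l \<Longrightarrow> l < k \<Longrightarrow> odd l \<Longrightarrow> w (Suc l) \<le> w l"
    and even: "\<And>l. 1 \<le> l \<Longrightarrow> l < k \<Longrightarrow> even l \<Longrightarrow> w (Suc l) + 2 * d \<le> w l"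
  obtains u e where "e > 0"
    "(\<Prod>l=1..k. [:- u l, 1:]) = (\<Prod>l=1..k. [:- w l, 1:]) - [:e:]"
    "\<And>l. 1 \<le> l \<Longrightarrow> l \<le> k \<Longrightarrow> odd l \<Longrightarrow> w l < u l \<and> u l < w l + d"
    "\<And>l. 1 \<le> l \<Longrightarrow> l \<le> k \<Longrightarrow> even l \<Longrightarrow> w l - d < u l \<and> u l < w l"
proof -
  define P where "P = (\<Prod>l=1..k. [:- w l, 1:])"
  \<comment> \<open>An even number of roots lies above \<open>r l\<close>, so \<open>P\<close> is positive there.\<close>
  define r where "r l = (if odd l then w l + d else w l - d)" for l
  have step: "w (Suc l) \<le> w l" if "1 \<le> l" "l < k" for l
    using odd[OF that] even[OF that] \<open>d > 0\<close> by (cases "odd l") auto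
  have anti: "w l' \<le> w l" if "1 \<le> l" "l \<le> l'" "l' \<le> k" for l l'
    using that(2,1,3) by (induction l' rule: dec_induct) (auto intro: order_trans[OF step])
  have pos: "poly P (r l) > 0" if l: "1 \<le> l" "l \<le> k" for l
  proof (cases "odd l")
    case True
    have "(- 1) ^ (l - 1) * (\<Prod>i=1..k. r l - w i) > 0"
    proof (rule prod_linear_sign)
      fix i assume i: "1 \<le> i" "i \<le> l - 1"
      have "w l + 2 * d \<le> w (l - 1)" using even[of "l - 1"] True i l by auto
      moreover have "w (l - 1) \<le> w i" using anti[of i "l - 1"] i l by auto
      ultimately show "r l < w i" using True \<open>d > 0\<close> by (simp add: r_def)
    next
      fix i assume "l - 1 < i" "i \<le> k"
      moreover from this have "l \<le> i" by linarith
      ultimately show "w i < r l" using anti[of l i] True \<open>d > 0\<close> l by (simp add: r_def)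
    qed (use l in auto)
    then show ?thesis using True by (simp add: P_def poly_prod_linear)
  next
    case False
    have "(- 1) ^ l * (\<Prod>i=1..k. r l - w i) > 0"
    proof (rule prod_linear_sign)
      fix i assume "1 \<le> i" "i \<le> l"
      then show "r l < w i" using anti[of i l] False \<open>d > 0\<close> l by (simp add: r_def)
    next
      fix i assume i: "l < i" "i \<le> k"
      have "w (Suc l) + 2 * d \<le> w l" using even[of l] False i l by auto
      moreover have "w i \<le> w (Suc l)" using anti[of "Suc l" i] i l by auto
      ultimately show "w i < r l" using False \<open>d > 0\<close> by (simp add: r_def)
    qed (use l in auto)
    then show ?thesis using False by (simp add: P_def poly_prod_linear)
  qed
  \<comment> \<open>Half of the least value, so that \<open>P\<close> lowered by \<open>e\<close> is
    still positive at every \<open>r l\<close>.\<close>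
  define e where "e = Min ((\<lambda>l. poly P (r l)) ` {1..k}) / 2"
  have "Min ((\<lambda>l. poly P (r l)) ` {1..k}) > 0"
    using pos \<open>k \<ge> 1\<close> by (subst Min_gr_iff) auto
  then have "e > 0" by (simp add: e_def)
  have e: "e < poly P (r l)" if "1 \<le> l" "l \<le> k" for l
  proof -
    have "Min ((\<lambda>l. poly P (r l)) ` {1..k}) \<le> poly P (r l)" using that by (intro Min_le) auto
    then show ?thesis using \<open>e > 0\<close> by (simp add: e_def)
  qed
  have root: "poly P (w l) = 0" if "1 \<le> l" "l \<le> k" for l
    using that by (auto simp: P_def poly_prod_linear)
  have "\<exists>t. poly (P - [:e:]) t = 0 \<and> (odd l \<longrightarrow> w l < t \<and> t < w l + d) \<and> (even l \<longrightarrow> w l - d < t \<and> t < w l)"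
    if l: "1 \<le> l" "l \<le> k" for l
  proof (cases "odd l")
    case True
    show ?thesis
      using poly_IVT_pos[of "w l" "r l" "P - [:e:]"] True l root[of l] e[of l] \<open>e > 0\<close> \<open>d > 0\<close>
      by (auto simp: r_def)
  next
    case False
    show ?thesis
      using poly_IVT_neg[of "r l" "w l" "P - [:e:]"] False l root[of l] e[of l] \<open>e > 0\<close> \<open>d > 0\<close>
      by (auto simp: r_def)
  qed
  then have "\<exists>u. \<forall>l. 1 \<le> l \<and> l \<le> k \<longrightarrow> poly (P - [:e:]) (u l) = 0
      \<and> (odd l \<longrightarrow> w l < u l \<and> u l < w l + d) \<and> (even l \<longrightarrow> w l - d < u l \<and> u l < w l)"
    by (intro choice) blast
  then obtain u where u: "\<And>l. 1 \<le> l \<Longrightarrow> l \<le> k \<Longrightarrow> poly (P - [:e:]) (u l) = 0"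
    "\<And>l. 1 \<le> l \<Longrightarrow> l \<le> k \<Longrightarrow> odd l \<Longrightarrow> w l < u l \<and> u l < w l + d"
    "\<And>l. 1 \<le> l \<Longrightarrow> l \<le> k \<Longrightarrow> even l \<Longrightarrow> w l - d < u l \<and> u l < w l"
    by blast
  \<comment> \<open>For odd \<open>l\<close> the two roots move apart; for even \<open>l\<close>
    they approach each other by less than \<open>2 * d\<close>, which the gap allows.\<close>
  have ustep: "u (Suc l) < u l" if "1 \<le> l" "l < k" for l
    using u(2)[of l] u(3)[of l] u(2)[of "Suc l"] u(3)[of "Suc l"] odd[of l] even[of l] that
    by (cases "odd l") auto
  have uanti: "u l' < u l" if "1 \<le> l" "l < l'" "l' \<le> k" for l l'
  proof -
    have "Suc l \<le> l'" using that by simp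
    then have "l' \<le> k \<longrightarrow> u l' < u l"
    proof (induction l' rule: dec_induct)
      case base
      then show ?case using ustep that by auto
    next
      case (step m)
      then show ?case using ustep[of m] that by auto
    qed
    then show ?thesis using that by simp
  qed
  have "inj_on u {1..k}"
    by (rule linorder_inj_onI) (use uanti in \<open>force+\<close>)
  then have card: "card (u ` {1..k}) = k" by (simp add: card_image)
  have deg: "degree P = k" "degree (\<Prod>l=1..k. [:- u l, 1:]) = k"
    using degree_prod_linear[of w "{1..k}"] degree_prod_linear[of u "{1..k}"] by (simp_all add: P_def)
  have "(\<Prod>l=1..k. [:- u l, 1:]) = P - [:e:]"
  proof (rule poly_eqI_degree_lead_coeff[of _ k _ "u ` {1..k}"])
    show "coeff (\<Prod>l=1..k. [:- u l, 1:]) k = coeff (P - [:e:]) k"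
      using lead_coeff_prod_linear[of w "{1..k}"] lead_coeff_prod_linear[of u "{1..k}"] \<open>k \<ge> 1\<close>
      by (simp add: P_def coeff_pCons split: nat.split)
    show "degree (P - [:e:]) \<le> k" using deg by (intro degree_diff_le) auto
    show "poly (\<Prod>l=1..k. [:- u l, 1:]) z = poly (P - [:e:]) z" if "z \<in> u ` {1..k}" for z
    proof -
      have "poly (\<Prod>l=1..k. [:- u l, 1:]) z = 0" using that by (auto simp: poly_prod_linear)
      then show ?thesis using that u(1) by auto
    qed
  qed (use card deg in auto)
  then show ?thesis using that[of e u] \<open>e > 0\<close> u(2,3) by (simp add: P_def)
qed

subsection \<open>Local maxima have block structure\<close>

text \<open>The disjunct \<open>n < b\<close> makes a run that reaches the last coordinate end at
  \<open>n + 1\<close>.\<close>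

definition run_end :: "nat \<Rightarrow> (nat \<Rightarrow> real) \<Rightarrow> nat \<Rightarrow> nat" where
  "run_end n x a = (LEAST b. a < b \<and> (n < b \<or> x b \<noteq> x a))"

lemma run_end:
  assumes "a \<le> n"
  shows "a < run_end n x a" "run_end n x a \<le> Suc n"
    "run_end n x a \<le> n \<Longrightarrow> x (run_end n x a) \<noteq> x a"
    "a \<le> b \<Longrightarrow> b < run_end n x a \<Longrightarrow> x b = x a"
proof -
  have ex: "a < Suc n \<and> (n < Suc n \<or> x (Suc n) \<noteq> x a)" using assms by simp
  show 1: "a < run_end n x a" "run_end n x a \<le> n \<Longrightarrow> x (run_end n x a) \<noteq> x a"
    using LeastI[of "\<lambda>b. a < b \<and> (n < b \<or> x b \<noteq> x a)", OF ex] by (auto simp: run_end_def)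
  show 2: "run_end n x a \<le> Suc n" unfolding run_end_def by (rule Least_le) (rule ex)
  show "x b = x a" if "a \<le> b" "b < run_end n x a"
    using not_less_Least[of b "\<lambda>b. a < b \<and> (n < b \<or> x b \<noteq> x a)"] that
    by (cases "a = b") (auto simp: run_end_def)
qed

text \<open>Blocks as long as condition (2) permits: one index for odd blocks, a whole run for even
  ones. Bounds are numbered from 1, so the case \<open>l = 0\<close> carries the start value over to
  index 1; a bound beyond \<open>n\<close> is repeated.\<close>

primrec greedy_bounds :: "nat \<Rightarrow> (nat \<Rightarrow> real) \<Rightarrow> nat \<Rightarrow> nat" where
  "greedy_bounds n x 0 = 1"
| "greedy_bounds n x (Suc l) =
    (if l = 0 \<or> n < greedy_bounds n x l then greedy_bounds n x l
     else if odd l then Suc (greedy_bounds n x l) else run_end n x (greedy_bounds n x l))"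

text \<open>If the greedy bounds pass \<open>n\<close> by step \<open>k\<close>, they satisfy (2).
  Otherwise blocks 1 to \<open>k\<close> are all nonempty and each supplies one index of the chain.
  The last index may be \<open>n\<close>, with no drop after it; hence the premise
  \<open>c l < n\<close>.\<close>

lemma block_bounds_or_chain:
  assumes x: "x \<in> S_set k n s" and "k \<ge> 1" "n \<ge> 1"
  obtains I where "block_bounds k n x I"
  | c where "c 1 = (1::nat)" "\<And>l. 1 \<le> l \<Longrightarrow> l \<le> k \<Longrightarrow> 1 \<le> c l \<and> c l \<le> n"
    "\<And>l. 1 \<le> l \<Longrightarrow> l < k \<Longrightarrow> c l < c (Suc l)"
    "\<And>l. 1 \<le> l \<Longrightarrow> l \<le> k \<Longrightarrow> even l \<Longrightarrow> c l < n \<Longrightarrow> x (Suc (c l)) < x (c l)"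
    "\<And>l. 1 < l \<Longrightarrow> l \<le> k \<Longrightarrow> odd l \<Longrightarrow> x (c l) < x (c l - 1)"
proof -
  define I where "I = greedy_bounds n x"
  have I1: "I 1 = 1" by (simp add: I_def)
  have stop: "I (Suc l) = I l" if "n < I l" for l using that by (simp add: I_def)
  have odd: "I (Suc l) = Suc (I l)" if "odd l" "I l \<le> n" for l
    using that by (auto simp: I_def elim: oddE)
  have even: "I (Suc l) = run_end n x (I l)" if "1 \<le> l" "even l" "I l \<le> n" for l
    using that by (auto simp: I_def)
  have up: "I l < I (Suc l)" if "1 \<le> l" "I l \<le> n" for l
    using odd[of l] even[of l] run_end(1)[of "I l" n x] that by (cases "odd l") auto
  have le: "I l \<le> I (Suc l)" if "1 \<le> l" for l
    using up[OF that] stop[of l] by (cases "I l \<le> n") auto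
  have mono: "I l \<le> I l'" if "1 \<le> l" "l \<le> l'" for l l'
    using that(2,1) by (induction l' rule: dec_induct) (auto intro: order_trans[OF _ le])
  have bound: "I l \<le> Suc n" if "1 \<le> l" for l
    using that
  proof (induction l rule: dec_induct)
    case base
    show ?case by (simp add: I1[simplified])
  next
    case (step l)
    then show ?case
      using odd[of l] even[of l] stop[of l] run_end(2)[of "I l" n x]
      by (cases "I l \<le> n"; cases "odd l") auto
  qed
  have const: "x a = x (I l)" if "1 \<le> l" "I l \<le> a" "a < I (Suc l)" for l a
  proof (cases "odd l")
    case True
    then show ?thesis using that odd[of l] stop[of l] by (cases "I l \<le> n") (auto simp: le_less_Suc_eq)
  next
    case False
    then show ?thesis
      using that even[of l] stop[of l] run_end(4)[of "I l" n a x] by (cases "I l \<le> n") auto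
  qed
  show ?thesis
  proof (cases "I k \<le> n")
    case False
    then have "I k = n + 1" using bound[OF \<open>k \<ge> 1\<close>] by simp
    moreover have "I (2 * j) - I (2 * j - 1) \<in> {0, 1}" if "1 \<le> j" for j
      using odd[of "2 * j - 1"] stop[of "2 * j - 1"] that by (cases "I (2 * j - 1) \<le> n") auto
    moreover have "x a = x b" if "1 \<le> j" "a \<in> {I j..<I (Suc j)}" "b \<in> {I j..<I (Suc j)}" for j a b
      using const[of j a] const[of j b] that by simp
    ultimately have "block_bounds k n x I"
      using I1 le unfolding block_bounds_def by (metis atLeastLessThan_iff)
    then show ?thesis by (rule that(1))
  next
    case Ik: True
    have In: "I l \<le> n" if "1 \<le> l" "l \<le> k" for l using mono[OF that] Ik by simp
    \<comment> \<open>Coordinates with odd \<open>l\<close> will move up and those with even \<open>l\<close> down, so the former must be the first and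
      the latter the last of their runs of equal coordinates.\<close>
    define c where "c l = (if odd l then I l else I (Suc l) - 1)" for l
    have cI: "I l \<le> c l" "c l < I (Suc l)" if "1 \<le> l" "l \<le> k" for l
      using up[OF that(1) In[OF that]] by (auto simp: c_def)
    have I_ge: "1 \<le> I l" if "1 \<le> l" for l using mono[OF order_refl that] I1 by simp
    show ?thesis
    proof (rule that(2)[of c])
      show "c 1 = 1" using I1 by (simp add: c_def)
      show "1 \<le> c l \<and> c l \<le> n" if "1 \<le> l" "l \<le> k" for l
        using I_ge[OF that(1)] cI[OF that] bound[of "Suc l"] by auto
      show "c l < c (Suc l)" if "1 \<le> l" "l < k" for l
        using cI(2)[of l] cI(1)[of "Suc l"] that by simp
      show drop: "x (Suc (c l)) < x (c l)" if l: "1 \<le> l" "l \<le> k" "even l" "c l < n" for l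
      proof -
        have eq: "Suc (c l) = run_end n x (I l)"
          using l cI[OF l(1,2)] even[OF l(1,3) In[OF l(1,2)]] by (simp add: c_def)
        have "x (Suc (c l)) \<noteq> x (I l)"
          using run_end(3)[OF In[OF l(1,2)], of x] eq l(4) by simp
        moreover have "x (c l) = x (I l)" using const[of l "c l"] cI[OF l(1,2)] l(1) by simp
        moreover have "x (Suc (c l)) \<le> x (c l)"
          using sorted_coords[OF x, of "c l" "Suc (c l)"] l I_ge[OF l(1)] cI(1)[OF l(1,2)] by simp
        ultimately show ?thesis by simp
      qed
      \<comment> \<open>The even block before ends right in front of \<open>c l\<close>, so the drop
        after that block is the one wanted here.\<close>
      show "x (c l) < x (c l - 1)" if l: "1 < l" "l \<le> k" "odd l" for l
      proof -
        have "1 \<le> l - 1" "l - 1 \<le> k" "even (l - 1)" using l by auto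
        moreover have "Suc (c (l - 1)) = c l"
          using l I_ge[of l] by (simp add: c_def)
        moreover have "c l \<le> n" using l In[of l] by (simp add: c_def)
        ultimately show ?thesis
          using drop[of "l - 1"]
          by (metis Suc_le_eq diff_Suc_1)
      qed
    qed
  qed
qed

section \<open>Moving coordinates without leaving \<open>S_set\<close>\<close>

text \<open>Half of the smallest strict drop, capped by \<open>e\<close>: neighbours that each move
  by less than \<open>d\<close> then keep their strict order.\<close>

lemma ex_gap:
  fixes x :: "nat \<Rightarrow> real"
  assumes "e > 0"
  obtains d where "d > 0" "d \<le> e" "\<And>m. m \<in> {1..<n} \<Longrightarrow> x (Suc m) < x m \<Longrightarrow> x (Suc m) + 2 * d \<le> x m"
proof -
  define G where "G = insert e ((\<lambda>m. (x m - x (Suc m)) / 2) ` {m \<in> {1..<n}. x (Suc m) < x m})"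
  have G: "finite G" "G \<noteq> {}" by (auto simp: G_def)
  have "Min G > 0" using assms by (subst Min_gr_iff[OF G]) (auto simp: G_def)
  moreover have "Min G \<le> e" using G by (intro Min_le) (auto simp: G_def)
  moreover have "x (Suc m) + 2 * Min G \<le> x m" if "m \<in> {1..<n}" "x (Suc m) < x m" for m
  proof -
    have "Min G \<le> (x m - x (Suc m)) / 2" using that G by (intro Min_le) (auto simp: G_def)
    then show ?thesis by simp
  qed
  ultimately show ?thesis by (rule that)
qed

text \<open>Each coordinate contributes at most \<open>d ^ 2\<close>; the factor
  \<open>n + 1\<close> in place of \<open>n\<close> makes the result strict.\<close>

lemma dist_n_less:
  assumes "\<And>i. i \<in> {1..n} \<Longrightarrow> \<bar>y i - x i\<bar> \<le> d" "d \<ge> 0" "real (n + 1) * d \<le> e" "e > 0"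
  shows "dist_n n y x < e"
proof -
  have "(\<Sum>i=1..n. (y i - x i)\<^sup>2) \<le> (\<Sum>i=1..n. d\<^sup>2)"
    using assms(1,2) by (intro sum_mono) (simp add: abs_le_square_iff[symmetric])
  also have "\<dots> \<le> (real n * d) * (real (n + 1) * d)"
  proof -
    have "real n * d\<^sup>2 \<le> real n * (real (n + 1) * d\<^sup>2)"
      by (intro mult_left_mono) (auto simp: algebra_simps)
    then show ?thesis by (simp add: power2_eq_square mult.assoc mult.left_commute)
  qed
  also have "\<dots> \<le> (real n * d) * e" using assms by (intro mult_left_mono) auto
  also have "\<dots> < e * e"
  proof (cases "d = 0")
    case False
    then have "real n * d < e" using assms(2,3) by (simp add: algebra_simps)
    then show ?thesis using assms(4) by simp
  qed (use assms in auto)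
  finally show ?thesis
    unfolding dist_n_def using assms(4) by (intro real_less_lsqrt) (auto simp: power2_eq_square)
qed

lemma local_max_imp_block_bounds:
  assumes "k \<ge> 1" "n \<ge> 1" and max: "is_local_max_pow k n s x"
  shows "\<exists>I. block_bounds k n x I"
proof -
  obtain e where x: "x \<in> S_set k n s" and e: "e > 0"
    and le: "\<And>y. y \<in> S_set k n s \<Longrightarrow> dist_n n y x < e \<Longrightarrow> (\<Sum>i=1..n. y i ^ k) \<le> (\<Sum>i=1..n. x i ^ k)"
    using max by (auto simp: is_local_max_pow_def)
  show ?thesis
    using x \<open>k \<ge> 1\<close> \<open>n \<ge> 1\<close>
  proof (cases rule: block_bounds_or_chain)
    case (1 I)
    then show ?thesis by blast
  next
    case (2 c)
    \<comment> \<open>\<open>d\<close> is small enough both to stay within distance \<open>e\<close>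
      of \<open>x\<close> and to preserve strict drops.\<close>
    obtain d where d: "d > 0" "d \<le> e / real (n + 1)"
      and gap: "\<And>m. m \<in> {1..<n} \<Longrightarrow> x (Suc m) < x m \<Longrightarrow> x (Suc m) + 2 * d \<le> x m"
      using ex_gap[of "e / real (n + 1)" n x] e by auto
    obtain u \<epsilon> where \<epsilon>: "\<epsilon> > 0"
      and roots: "(\<Prod>l=1..k. [:- u l, 1:]) = (\<Prod>l=1..k. [:- x (c l), 1:]) - [:\<epsilon>:]"
      and u_odd: "\<And>l. 1 \<le> l \<Longrightarrow> l \<le> k \<Longrightarrow> odd l \<Longrightarrow> x (c l) < u l \<and> u l < x (c l) + d"
      and u_even: "\<And>l. 1 \<le> l \<Longrightarrow> l \<le> k \<Longrightarrow> even l \<Longrightarrow> x (c l) - d < u l \<and> u l < x (c l)"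
    proof (rule ex_shifted_roots[of k d "\<lambda>l. x (c l)"])
      show "x (c (Suc l)) \<le> x (c l)" if "1 \<le> l" "l < k" for l
        using sorted_coords[OF x, of "c l" "c (Suc l)"] 2(2)[of l] 2(2)[of "Suc l"] 2(3)[of l] that
        by simp
      show "x (c (Suc l)) + 2 * d \<le> x (c l)" if "1 \<le> l" "l < k" "even l" for l
      proof -
        have "c l < c (Suc l)" "1 \<le> c l" "c (Suc l) \<le> n"
          using 2(2)[of l] 2(2)[of "Suc l"] 2(3)[of l] that by auto
        then have "x (Suc (c l)) + 2 * d \<le> x (c l)" "x (c (Suc l)) \<le> x (Suc (c l))"
          using gap[of "c l"] 2(4)[of l] that sorted_coords[OF x, of "Suc (c l)" "c (Suc l)"] by auto
        then show ?thesis by simp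
      qed
    qed (use \<open>k \<ge> 1\<close> d in auto)
    have cmono: "c l < c l'" if "1 \<le> l" "l < l'" "l' \<le> k" for l l'
    proof -
      have "Suc l \<le> l'" using that by simp
      then have "l' \<le> k \<longrightarrow> c l < c l'"
      proof (induction l' rule: dec_induct)
        case base
        then show ?case using 2(3) that by auto
      next
        case (step m)
        then show ?case using 2(3)[of m] that by auto
      qed
      then show ?thesis using that by simp
    qed
    have inj: "inj_on c {1..k}"
      by (rule linorder_inj_onI) (use cmono in \<open>force+\<close>)
    define C where "C = c ` {1..k}"
    define y where "y m = (if m \<in> C then u (the_inv_into {1..k} c m) else x m)" for m
    have yc: "y (c l) = u l" if "1 \<le> l" "l \<le> k" for l
      using that the_inv_into_f_f[OF inj, of l] by (simp add: y_def C_def)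
    have ynot: "y m = x m" if "m \<notin> C" for m using that by (simp add: y_def)
    have CD: "\<exists>l. 1 \<le> l \<and> l \<le> k \<and> m = c l" if "m \<in> C" for m using that by (auto simp: C_def)
    have close: "y m < x m + d \<and> x m - d < y m" for m
    proof (cases "m \<in> C")
      case True
      then obtain l where "1 \<le> l" "l \<le> k" "m = c l" using CD by blast
      then show ?thesis using u_odd[of l] u_even[of l] yc[of l] d by (cases "odd l") auto
    qed (use ynot d in auto)
    have up: "x m \<le> y m" if "\<And>l. 1 \<le> l \<Longrightarrow> l \<le> k \<Longrightarrow> even l \<Longrightarrow> c l \<noteq> m" for m
    proof (cases "m \<in> C")
      case True
      then obtain l where "1 \<le> l" "l \<le> k" "m = c l" using CD by blast
      then show ?thesis using u_odd[of l] that[of l] yc[of l] by (cases "odd l") auto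
    qed (use ynot in auto)
    have down: "y m \<le> x m" if "\<And>l. 1 \<le> l \<Longrightarrow> l \<le> k \<Longrightarrow> odd l \<Longrightarrow> c l \<noteq> m" for m
    proof (cases "m \<in> C")
      case True
      then obtain l where "1 \<le> l" "l \<le> k" "m = c l" using CD by blast
      then show ?thesis using u_even[of l] that[of l] yc[of l] by (cases "odd l") auto
    qed (use ynot in auto)
    \<comment> \<open>A strict drop survives moves below \<open>d\<close>. Within a run of equal
      coordinates only the first can move up and only the last can move down, so equal neighbours do
      not cross.\<close>
    have sorted: "y (Suc m) \<le> y m" if m: "m \<in> {1..<n}" for m
    proof (cases "x (Suc m) < x m")
      case True
      then show ?thesis using gap[OF m] close[of m] close[of "Suc m"] by linarith
    next
      case False
      then have eq: "x (Suc m) = x m" using x m by (force simp: S_set_def)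
      have "x m \<le> y m"
        using 2(4) eq m by (intro up) force
      moreover have "y (Suc m) \<le> x (Suc m)"
      proof (rule down)
        fix l assume l: "1 \<le> l" "l \<le> k" "odd l"
        show "c l \<noteq> Suc m"
          using 2(5)[of l] 2(1) l eq m by (cases "l = 1") auto
      qed
      ultimately show ?thesis using eq by simp
    qed
    have CN: "C \<subseteq> {1..n}" using 2(2) by (force simp: C_def)
    have sums: "(\<Sum>m=1..n. z m ^ j) = (\<Sum>m\<in>{1..n} - C. z m ^ j) + (\<Sum>l=1..k. z (c l) ^ j)" for z :: "nat \<Rightarrow> real" and j
      using sum.subset_diff[OF CN, of "\<lambda>m. z m ^ j"] inj by (simp add: C_def sum.reindex)
    \<comment> \<open>The coordinates outside \<open>C\<close> cancel, which leaves the roots of the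
      two products.\<close>
    have diff: "(\<Sum>m=1..n. y m ^ j) - (\<Sum>m=1..n. x m ^ j) = (\<Sum>l=1..k. u l ^ j) - (\<Sum>l=1..k. x (c l) ^ j)" for j
      using sums[of y j] sums[of x j] ynot yc by simp
    note shift = power_sums_shift_const[OF _ roots, simplified]
    have "(\<Sum>m=1..n. y m ^ j) = (\<Sum>m=1..n. x m ^ j)" if "j \<in> {1..k-1}" for j
    proof -
      have "j < k" using that \<open>k \<ge> 1\<close> by auto
      then show ?thesis using diff[of j] shift(1)[of j] by simp
    qed
    then have "y \<in> S_set k n s" using sorted x by (simp add: S_set_def)
    moreover have "dist_n n y x < e"
    proof (rule dist_n_less)
      show "\<bar>y i - x i\<bar> \<le> d" for i using close[of i] by linarith
      show "real (n + 1) * d \<le> e" using d(2) by (simp add: field_simps)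
    qed (use d e in auto)
    ultimately have "(\<Sum>m=1..n. y m ^ k) \<le> (\<Sum>m=1..n. x m ^ k)" by (rule le)
    then have "real k * \<epsilon> \<le> 0" using diff[of k] shift(2) by simp
    then show ?thesis using \<epsilon> \<open>k \<ge> 1\<close> by (simp add: mult_le_0_iff)
  qed
qed

section \<open>Closing the cycle (1) ==> (2) ==> (3) ==> (1)\<close>

theorem mainTheorem14:
  fixes k n :: nat and s x :: "nat \<Rightarrow> real"
  assumes "k \<ge> 3" and "n \<ge> k" and "x \<in> S_set k n s"
  shows "(is_local_max_pow k n s x \<longleftrightarrow>
            (\<exists>i :: nat \<Rightarrow> nat. i 1 = 1 \<and> i k = n + 1 \<and>
               (\<forall>j\<in>{1..<k}. i j \<le> i (Suc j)) \<and>
               (\<forall>j\<in>{1..<k}. \<forall>a\<in>{i j..<i (Suc j)}. \<forall>b\<in>{i j..<i (Suc j)}. x a = x b) \<and>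
               (\<forall>j. 1 \<le> j \<and> 2 * j \<le> k \<longrightarrow> i (2 * j) - i (2 * j - 1) \<in> {0, 1})))
       \<and> ((\<exists>i :: nat \<Rightarrow> nat. i 1 = 1 \<and> i k = n + 1 \<and>
               (\<forall>j\<in>{1..<k}. i j \<le> i (Suc j)) \<and>
               (\<forall>j\<in>{1..<k}. \<forall>a\<in>{i j..<i (Suc j)}. \<forall>b\<in>{i j..<i (Suc j)}. x a = x b) \<and>
               (\<forall>j. 1 \<le> j \<and> 2 * j \<le> k \<longrightarrow> i (2 * j) - i (2 * j - 1) \<in> {0, 1}))
            \<longleftrightarrow> (\<forall>y\<in>S_set k n s. k_majorizes k n x y))"
proof -
  have "\<exists>i. block_bounds k n x i" if "is_local_max_pow k n s x"
    using local_max_imp_block_bounds[OF _ _ that] assms by simp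
  moreover have "k_majorizes k n x y" if "\<exists>i. block_bounds k n x i" "y \<in> S_set k n s" for y
    using block_bounds_imp_majorizes assms that by blast
  \<comment> \<open>The test function is \<open>t ^ k\<close>. Majorization makes \<open>x\<close> a
    global maximum on \<open>S_set k n s\<close>, so the radius 1 supplied by
    \<open>zero_less_one\<close> works.\<close>
  moreover have "is_local_max_pow k n s x" if "\<forall>y\<in>S_set k n s. k_majorizes k n x y"
    using that k_convex_power assms(3) zero_less_one
    unfolding is_local_max_pow_def k_majorizes_def by blast
  ultimately have "(is_local_max_pow k n s x \<longleftrightarrow> (\<exists>i. block_bounds k n x i)) \<and>
      ((\<exists>i. block_bounds k n x i) \<longleftrightarrow> (\<forall>y\<in>S_set k n s. k_majorizes k n x y))"
    by blast
  then show ?thesis unfolding block_bounds_def .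
qed

end
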